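(* Let $d\ge1$, $p>2$, $\Omega\subset\mathbb{R}^d$ bounded and $\epsilon>0$ (with $m(\epsilon)\le M(\epsilon)$). Let $g_1,g_2\in C_b(\mathbb{R}^d\setminus\Omega)$ and $u_{0,1},u_{0,2}\in C_b(\overline\Omega)$. Let $\overline u,\underline u:\mathbb{R}^d\times\mathbb{R}\to\mathbb{R}$ be two bounded measurable functions such that $$\begin{cases}\overline u(x,t+\epsilon^2/2)\ge\mathcal{A}_\epsilon[\overline u](x,t),&\text{in }\Omega\times(-\epsilon^2/2,\infty),\\ \overline u(x,t)\ge u_{0,1}(x),&\text{in }\Omega\times(-\epsilon^2/2,0],\\ \overline u(x,t)\ge g_1(x),&\text{in }(\mathbb{R}^d\setminus\Omega)\times(-\epsilon^2/2,\infty),\end{cases}$$ $$\begin{cases}\underline u(x,t+\epsilon^2/2)\le\mathcal{A}_\epsilon[\underline u](x,t),&\text{in }\Omega\times(-\epsilon^2/2,\infty),\\ \underline u(x,t)\le u_{0,2}(x),&\text{in }\Omega\times(-\epsilon^2/2,0],\\ \underline u(x,t)\le g_2(x),&\text{in }(\mathbb{R}^d\setminus\Omega)\times(-\epsilon^2/2,\infty).\end{cases}$$ If $u_{0,1}\ge u_{0,2}$ in $\Omega$ and $g_1\ge g_2$ in $\mathbb{R}^d\setminus\Omega$, then: a) For any $t_0\in(-\epsilon^2/2,0]$ and $j\in\mathbb{N}\cup\{0\}$, writing $t_j=t_0+j\epsilon^2/2$: if $\underline u(x,t_j)\le\overline u(x,t_j)$ for all $x\in\mathbb{R}^d$, then $\underline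 u(x,t_{j+1})\le\overline u(x,t_{j+1})$ for all $x\in\mathbb{R}^d$. b) $\underline u(x,t)\le\overline u(x,t)$ for all $(x,t)\in\mathbb{R}^d\times(-\epsilon^2/2,\infty)$.
   Context: $C_b$ denotes bounded continuous functions and $B_r(x)$ the ball of radius $r$ centered at $x$. Set $\alpha=\frac{p-2}{p-1}$, $\beta=\frac{p-2}{p+d}$, $\gamma=\sqrt{2(p+d)}$. The functions $m,M:(0,\infty)\to(0,\infty)$ satisfy: $m$ is nondecreasing with $m(\epsilon)\to0$ and $\epsilon\,m(\epsilon)^{-\alpha/2}\to0$ as $\epsilon\to0^+$; $M$ is nonincreasing with $M(\epsilon)\to+\infty$ and $\epsilon^2M(\epsilon)^{1-\alpha}\to0$ as $\epsilon\to0^+$. For $\rho>0$, $$M_\rho[\varphi](x)=\frac\beta2\Big(\sup_{B_{\gamma\rho}(x)}\varphi+\inf_{B_{\gamma\rho}(x)}\varphi\Big)+(1-\beta)\frac{1}{|B_{\gamma\rho}(x)|}\int_{B_{\gamma\rho}(x)}\varphi(y)\,dy,$$ and $$\mathcal{A}_\epsilon[\varphi](x)=\frac12\max\Big[\inf_{c\in[m(\epsilon),M(\epsilon)]}\Big\{\alpha\sup_{B_{\epsilon^2c^{1-\alpha}}(x)}\varphi+(1-\alpha)M_{\epsilon c^{-\alpha/2}}[\varphi](x)\Big\},\varphi(x)\Big]+\frac12\min\Big[\sup_{c\in[m(\epsilon),M(\epsilon)]}\Big\{\alpha\inf_{B_{\epsilon^2c^{1-\alpha}}(x)}\varphi+(1-\alpha)M_{\epsilon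 c^{-\alpha/2}}[\varphi](x)\Big\},\varphi(x)\Big].$$ For $\varphi$ depending on $(x,t)$, $\mathcal{A}_\epsilon[\varphi](x,t)=\mathcal{A}_\epsilon[\varphi(\cdot,t)](x)$. *)

theory Defs
  imports "HOL-Analysis.Analysis"
begin

text \<open>Bounded continuous functions on a subset \<open>S\<close>. Functions are total in HOL; the
  values outside \<open>S\<close> are irrelevant.\<close>

definition C_b :: "'a::topological_space set \<Rightarrow> ('a \<Rightarrow> real) set" where
  "C_b S = {f. continuous_on S f \<and> bounded (f ` S)}"

definition alpha :: "real \<Rightarrow> real" where
  "alpha p = (p - 2) / (p - 1)"

definition beta :: "nat \<Rightarrow> real \<Rightarrow> real" where
  "beta d p = (p - 2) / (p + real d)"

definition gam :: "nat \<Rightarrow> real \<Rightarrow> real" where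
  "gam d p = sqrt (2 * (p + real d))"

text \<open>In the two operators below the dimension is \<open>d = CARD('d)\<close> and balls are open.
  The real-valued \<open>SUP\<close>, \<open>INF\<close> and Bochner integral have their
  usual meaning because the operators are applied to bounded Borel functions, with positive
  radii and \<open>m \<epsilon> \<le> M \<epsilon>\<close>; otherwise their values are unspecified
  or conventional.\<close>

definition mean_op :: "real \<Rightarrow> real \<Rightarrow> (real^'d \<Rightarrow> real) \<Rightarrow> real^'d \<Rightarrow> real" where
  "mean_op p \<rho> \<phi> x =
    (let B = ball x (gam CARD('d) p * \<rho>) in
       beta CARD('d) p / 2 * ((SUP y\<in>B. \<phi> y) + (INF y\<in>B. \<phi> y))
       + (1 - beta CARD('d) p) * (1 / measure lebesgue B * (LINT y:B|lebesgue. \<phi> y)))"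

definition A_op ::
  "real \<Rightarrow> (real \<Rightarrow> real) \<Rightarrow> (real \<Rightarrow> real) \<Rightarrow> real \<Rightarrow> (real^'d \<Rightarrow> real) \<Rightarrow> real^'d \<Rightarrow> real" where
  "A_op p m M \<epsilon> \<phi> x =
    1 / 2 * max
      (INF c\<in>{m \<epsilon>..M \<epsilon>}.
         alpha p * (SUP y\<in>ball x (\<epsilon>\<^sup>2 * c powr (1 - alpha p)). \<phi> y)
         + (1 - alpha p) * mean_op p (\<epsilon> * c powr (- alpha p / 2)) \<phi> x)
      (\<phi> x)
  + 1 / 2 * min
      (SUP c\<in>{m \<epsilon>..M \<epsilon>}.
         alpha p * (INF y\<in>ball x (\<epsilon>\<^sup>2 * c powr (1 - alpha p)). \<phi> y)
         + (1 - alpha p) * mean_op p (\<epsilon> * c powr (- alpha p / 2)) \<phi> x)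
      (\<phi> x)"

definition A_op_time ::
  "real \<Rightarrow> (real \<Rightarrow> real) \<Rightarrow> (real \<Rightarrow> real) \<Rightarrow> real \<Rightarrow> ((real^'d) \<times> real \<Rightarrow> real) \<Rightarrow> (real^'d) \<times> real \<Rightarrow> real" where
  "A_op_time p m M \<epsilon> \<phi> = (\<lambda>(x, t). A_op p m M \<epsilon> (\<lambda>y. \<phi> (y, t)) x)"

definition admissible_lower :: "real \<Rightarrow> (real \<Rightarrow> real) \<Rightarrow> bool" where
  "admissible_lower p m \<longleftrightarrow>
     (\<forall>\<epsilon>>0. m \<epsilon> > 0) \<and> mono_on {0<..} m \<and> (m \<longlongrightarrow> 0) (at_right 0) \<and>
     ((\<lambda>\<epsilon>. \<epsilon> * m \<epsilon> powr (- alpha p / 2)) \<longlongrightarrow> 0) (at_right 0)"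

definition admissible_upper :: "real \<Rightarrow> (real \<Rightarrow> real) \<Rightarrow> bool" where
  "admissible_upper p M \<longleftrightarrow>
     (\<forall>\<epsilon>>0. M \<epsilon> > 0) \<and> antimono_on {0<..} M \<and> filterlim M at_top (at_right 0) \<and>
     ((\<lambda>\<epsilon>. \<epsilon>\<^sup>2 * M \<epsilon> powr (1 - alpha p)) \<longlongrightarrow> 0) (at_right 0)"

end

theory Submission
  imports Defs
begin

text \<open>The scheme is monotone. For p > 2 the weights \<open>alpha p\<close>,
  \<open>1 - alpha p\<close>, \<open>beta d p\<close>, \<open>1 - beta d p\<close> are nonnegative,
  and suprema, infima, averages, max and min all preserve pointwise order, so \<open>A_op\<close>
  does too (\<open>A_op_mono\<close>). With h = \<open>\<epsilon>\<^sup>2 / 2\<close>, an order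
  u_under <= u_over at time t thus gives, in \<Omega>, u_under(t+h) <= A[u_under](t) <= A[u_over](t)
  <= u_over(t+h); off \<Omega> the data g2 <= g1 separate the functions at all times. This is a). On
  (-h, 0] the order comes from the initial and exterior data, and every t > -h is t0 + jh with t0 in
  that window, so b) follows by induction on j. The delicate point is that real suprema and infima
  are monotone only for nonempty, suitably bounded families, and integrals only for integrable
  functions.\<close>

lemma bdd_image_of_bounded_range:
  fixes f :: "'a \<Rightarrow> real"
  assumes "bounded (range f)"
  shows "bdd_above (f ` S)" "bdd_below (f ` S)"
  using bounded_imp_bdd_above[OF assms] bounded_imp_bdd_below[OF assms]
  by (auto intro: bdd_above_mono bdd_below_mono)

text \<open>A non-integrable function has Bochner integral 0 by convention, so comparing averages
  requires this first. A bounded measurable function is integrable on a set of finite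
  measure.\<close>

lemma set_integrable_ball_bounded:
  fixes \<phi> :: "real^'d \<Rightarrow> real"
  assumes "\<phi> \<in> borel_measurable borel" and "bounded (range \<phi>)"
  shows "set_integrable lebesgue (ball x r) \<phi>"
proof -
  obtain K where K: "\<And>y. norm (\<phi> y) \<le> K"
    using assms(2) by (auto simp: bounded_iff)
  have "integrable lebesgue (\<lambda>y. indicator (ball x r) y *\<^sub>R \<phi> y)"
  proof (rule integrableI_bounded_set_indicator)
    show "\<phi> \<in> borel_measurable lebesgue"
      using assms(1) by (simp add: measurable_completion)
    show "emeasure lebesgue (ball x r) < \<infinity>"
      using emeasure_lborel_ball_finite[of x r] by simp
  qed (use K in auto)
  then show ?thesis by (simp add: set_integrable_def)
qed

lemma alpha_bounds:
  assumes "p > 2"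
  shows "0 < alpha p" "alpha p < 1"
  using assms by (auto simp: alpha_def divide_simps)

lemma beta_bounds:
  assumes "p > 2"
  shows "0 < beta d p" "beta d p \<le> 1"
  using assms by (auto simp: beta_def divide_simps)

lemma gam_pos:
  assumes "p > 2"
  shows "0 < gam d p"
  using assms by (auto simp: gam_def)

text \<open>Each of the three terms is monotone and carries a nonnegative weight; a positive radius
  keeps the ball nonempty.\<close>

lemma mean_op_mono:
  fixes \<phi> \<psi> :: "real^'d \<Rightarrow> real"
  assumes "p > 2" and "\<rho> > 0"
    and \<phi>: "\<phi> \<in> borel_measurable borel" "bounded (range \<phi>)"
    and \<psi>: "\<psi> \<in> borel_measurable borel" "bounded (range \<psi>)"
    and le: "\<And>y. \<phi> y \<le> \<psi> y"
  shows "mean_op p \<rho> \<phi> x \<le> mean_op p \<rho> \<psi> x"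
proof -
  define B where "B = ball x (gam CARD('d) p * \<rho>)"
  have ne: "B \<noteq> {}"
    using mult_pos_pos[OF gam_pos[OF \<open>p > 2\<close>] \<open>\<rho> > 0\<close>] by (simp add: B_def not_le)
  have "(SUP y\<in>B. \<phi> y) \<le> (SUP y\<in>B. \<psi> y)"
    by (rule cSUP_mono[OF ne bdd_image_of_bounded_range(1)[OF \<psi>(2)]]) (use le in blast)
  moreover have "(INF y\<in>B. \<phi> y) \<le> (INF y\<in>B. \<psi> y)"
    by (rule cINF_mono[OF ne bdd_image_of_bounded_range(2)[OF \<phi>(2)]]) (use le in blast)
  moreover have "(LINT y:B|lebesgue. \<phi> y) \<le> (LINT y:B|lebesgue. \<psi> y)"
    unfolding B_def
    by (intro set_integral_mono set_integrable_ball_bounded \<phi> \<psi> le)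
  ultimately show ?thesis
    unfolding mean_op_def Let_def B_def[symmetric] using beta_bounds[OF \<open>p > 2\<close>, of "CARD('d)"]
    by (intro add_mono mult_left_mono) auto
qed

text \<open>The weights sum to one, and the ball has positive finite measure, so the average is a
  true average. Together with monotonicity this bounds \<open>mean_op\<close> by the bounds of its
  argument.\<close>

lemma mean_op_const:
  fixes x :: "real^'d"
  assumes "p > 2" and "\<rho> > 0"
  shows "mean_op p \<rho> (\<lambda>_. K) x = K"
proof -
  define r where "r = gam CARD('d) p * \<rho>"
  have r: "r > 0"
    using gam_pos[OF \<open>p > 2\<close>] \<open>\<rho> > 0\<close> by (simp add: r_def)
  have "measure lebesgue (ball x r) > 0"
    using content_ball_pos[OF r, of x] by simp
  moreover have "(LINT y:ball x r|lebesgue. K) = measure lebesgue (ball x r) * K"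
    using emeasure_lborel_ball_finite[of x r] by (subst set_integral_const) auto
  ultimately show ?thesis
    using r unfolding mean_op_def Let_def r_def[symmetric]
    by (simp add: algebra_simps)
qed

lemma A_op_mono:
  fixes \<phi> \<psi> :: "real^'d \<Rightarrow> real"
  assumes "p > 2" and "\<epsilon> > 0" and "m \<epsilon> > 0" and "m \<epsilon> \<le> M \<epsilon>"
    and \<phi>: "\<phi> \<in> borel_measurable borel" "bounded (range \<phi>)"
    and \<psi>: "\<psi> \<in> borel_measurable borel" "bounded (range \<psi>)"
    and le: "\<And>y. \<phi> y \<le> \<psi> y"
  shows "A_op p m M \<epsilon> \<phi> x \<le> A_op p m M \<epsilon> \<psi> x"
proof -
  define R where "R c = \<epsilon>\<^sup>2 * c powr (1 - alpha p)" for c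
  define S where "S f c = alpha p * (SUP y\<in>ball x (R c). f y)
      + (1 - alpha p) * mean_op p (\<epsilon> * c powr (- alpha p / 2)) f x" for f c
  define I where "I f c = alpha p * (INF y\<in>ball x (R c). f y)
      + (1 - alpha p) * mean_op p (\<epsilon> * c powr (- alpha p / 2)) f x" for f c
  let ?C = "{m \<epsilon>..M \<epsilon>}"
  have ne: "?C \<noteq> {}" using \<open>m \<epsilon> \<le> M \<epsilon>\<close> by simp
  \<comment> \<open>Here c >= \<open>m \<epsilon>\<close> > 0 matters: it makes both powers of c
    positive, hence all balls nonempty.\<close>
  have pos: "R c > 0" "\<epsilon> * c powr (- alpha p / 2) > 0" if "c \<in> ?C" for c
    using that \<open>\<epsilon> > 0\<close> \<open>m \<epsilon> > 0\<close> by (auto simp: R_def)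
  \<comment> \<open>Stated for arbitrary f and g, since it serves both for \<phi> against \<psi> and
    for either of them against a constant.\<close>
  have mono: "S f c \<le> S g c" "I f c \<le> I g c"
    if c: "c \<in> ?C" and f: "f \<in> borel_measurable borel" "bounded (range f)"
      and g: "g \<in> borel_measurable borel" "bounded (range g)"
      and fg: "\<And>y. f y \<le> g y" for f g c
  proof -
    have ball: "ball x (R c) \<noteq> {}" using pos(1)[OF c] by simp
    have "(SUP y\<in>ball x (R c). f y) \<le> (SUP y\<in>ball x (R c). g y)"
      by (rule cSUP_mono[OF ball bdd_image_of_bounded_range(1)[OF g(2)]]) (use fg in blast)
    moreover have "(INF y\<in>ball x (R c). f y) \<le> (INF y\<in>ball x (R c). g y)"
      by (rule cINF_mono[OF ball bdd_image_of_bounded_range(2)[OF f(2)]]) (use fg in blast)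
    moreover note mean_op_mono[OF \<open>p > 2\<close> pos(2)[OF c] f g fg, of x]
    ultimately show "S f c \<le> S g c" "I f c \<le> I g c"
      unfolding S_def I_def using alpha_bounds[OF \<open>p > 2\<close>]
      by (auto intro!: add_mono mult_left_mono)
  qed
  text \<open>Comparing with constants gives the boundedness in \<open>c\<close> without which the real-valued
    \<open>INF\<close> and \<open>SUP\<close> over \<open>c\<close> would be junk and not monotone.\<close>
  have const: "S (\<lambda>_. K) c = K" "I (\<lambda>_. K) c = K" if "c \<in> ?C" for K c
    using pos[OF that] mean_op_const[OF \<open>p > 2\<close> pos(2)[OF that], of K x]
    by (simp_all add: S_def I_def algebra_simps)
  obtain K where K: "\<And>y. - K \<le> \<phi> y"
    using \<phi>(2) by (auto simp: bounded_iff abs_le_iff) (metis minus_le_iff)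
  obtain L where L: "\<And>y. \<psi> y \<le> L"
    using \<psi>(2) by (auto simp: bounded_iff abs_le_iff)
  \<comment> \<open>Monotonicity of the infimum needs a lower bound for the smaller family only;
    dually, the supremum below needs an upper bound for the larger one.\<close>
  have "bdd_below (S \<phi> ` ?C)"
  proof (rule bdd_belowI2)
    fix c assume c: "c \<in> ?C"
    show "- K \<le> S \<phi> c"
      using mono(1)[OF c _ _ \<phi>, of "\<lambda>_. - K"] const(1)[OF c, of "- K"] K by simp
  qed
  then have "(INF c\<in>?C. S \<phi> c) \<le> (INF c\<in>?C. S \<psi> c)"
    by (rule cINF_mono[OF ne]) (use mono(1) \<phi> \<psi> le in blast)
  moreover have "bdd_above (I \<psi> ` ?C)"
  proof (rule bdd_aboveI2)
    fix c assume c: "c \<in> ?C"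
    show "I \<psi> c \<le> L"
      using mono(2)[OF c \<psi>, of "\<lambda>_. L"] const(2)[OF c, of L] L by simp
  qed
  then have "(SUP c\<in>?C. I \<phi> c) \<le> (SUP c\<in>?C. I \<psi> c)"
    by (rule cSUP_mono[OF ne]) (use mono(2) \<phi> \<psi> le in blast)
  ultimately show ?thesis
    unfolding A_op_def S_def[symmetric, unfolded R_def] I_def[symmetric, unfolded R_def]
    using le[of x]
    by (intro add_mono mult_left_mono max.mono min.mono) (auto simp: S_def I_def R_def)
qed

theorem theorem4p2:
  fixes p \<epsilon> :: real
    and m M :: "real \<Rightarrow> real"
    and \<Omega> :: "(real^'d) set"
    and g1 g2 u01 u02 :: "real^'d \<Rightarrow> real"
    and u_over u_under :: "(real^'d) \<times> real \<Rightarrow> real"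
  assumes "p > 2" and "bounded \<Omega>" and "\<epsilon> > 0"
    and "admissible_lower p m" and "admissible_upper p M" and "m \<epsilon> \<le> M \<epsilon>"
    and "g1 \<in> C_b (- \<Omega>)" and "g2 \<in> C_b (- \<Omega>)"
    and "u01 \<in> C_b (closure \<Omega>)" and "u02 \<in> C_b (closure \<Omega>)"
    and "u_over \<in> borel_measurable borel" and "bounded (range u_over)"
    and "u_under \<in> borel_measurable borel" and "bounded (range u_under)"
    and "\<And>x t. x \<in> \<Omega> \<Longrightarrow> t > - \<epsilon>\<^sup>2 / 2 \<Longrightarrow>
           u_over (x, t + \<epsilon>\<^sup>2 / 2) \<ge> A_op_time p m M \<epsilon> u_over (x, t)"
    and "\<And>x t. x \<in> \<Omega> \<Longrightarrow> t \<in> {- \<epsilon>\<^sup>2 / 2<..0} \<Longrightarrow> u_over (x, t) \<ge> u01 x"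
    and "\<And>x t. x \<in> - \<Omega> \<Longrightarrow> t > - \<epsilon>\<^sup>2 / 2 \<Longrightarrow> u_over (x, t) \<ge> g1 x"
    and "\<And>x t. x \<in> \<Omega> \<Longrightarrow> t > - \<epsilon>\<^sup>2 / 2 \<Longrightarrow>
           u_under (x, t + \<epsilon>\<^sup>2 / 2) \<le> A_op_time p m M \<epsilon> u_under (x, t)"
    and "\<And>x t. x \<in> \<Omega> \<Longrightarrow> t \<in> {- \<epsilon>\<^sup>2 / 2<..0} \<Longrightarrow> u_under (x, t) \<le> u02 x"
    and "\<And>x t. x \<in> - \<Omega> \<Longrightarrow> t > - \<epsilon>\<^sup>2 / 2 \<Longrightarrow> u_under (x, t) \<le> g2 x"
    and "\<And>x. x \<in> \<Omega> \<Longrightarrow> u01 x \<ge> u02 x"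
    and "\<And>x. x \<in> - \<Omega> \<Longrightarrow> g1 x \<ge> g2 x"
  shows "(\<forall>t0 \<in> {- \<epsilon>\<^sup>2 / 2<..0}. \<forall>j::nat.
            (\<forall>x. u_under (x, t0 + real j * \<epsilon>\<^sup>2 / 2) \<le> u_over (x, t0 + real j * \<epsilon>\<^sup>2 / 2)) \<longrightarrow>
            (\<forall>x. u_under (x, t0 + real (j + 1) * \<epsilon>\<^sup>2 / 2) \<le> u_over (x, t0 + real (j + 1) * \<epsilon>\<^sup>2 / 2)))
       \<and> (\<forall>x. \<forall>t > - \<epsilon>\<^sup>2 / 2. u_under (x, t) \<le> u_over (x, t))"
proof -
  let ?h = "\<epsilon>\<^sup>2 / 2"
  have h: "?h > 0" using \<open>\<epsilon> > 0\<close> by simp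
  have neg: "- \<epsilon>\<^sup>2 / 2 = - ?h" by simp
  \<comment> \<open>\<open>A_op\<close> acts at fixed time, so its hypotheses must pass to time
    slices: a slice is u composed with the continuous map y -> (y, t).\<close>
  have slice: "(\<lambda>y. u (y, t)) \<in> borel_measurable borel" "bounded (range (\<lambda>y. u (y, t)))"
    if "u \<in> borel_measurable borel" "bounded (range u)" for u :: "(real^'d) \<times> real \<Rightarrow> real" and t
  proof -
    have "(\<lambda>y::real^'d. (y, t)) \<in> borel \<rightarrow>\<^sub>M borel"
      by (intro borel_measurable_continuous_onI continuous_intros)
    from measurable_compose[OF this that(1)]
    show "(\<lambda>y. u (y, t)) \<in> borel_measurable borel" .
    show "bounded (range (\<lambda>y. u (y, t)))"
      by (rule bounded_subset[OF that(2)]) auto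
  qed
  have outside: "u_under (x, t) \<le> u_over (x, t)" if "x \<notin> \<Omega>" "t > - \<epsilon>\<^sup>2 / 2" for x t
    using assms(17)[of x t] assms(20)[of x t] assms(22)[of x] that by force
  have initial: "u_under (x, t) \<le> u_over (x, t)" if "t \<in> {- \<epsilon>\<^sup>2 / 2<..0}" for x t
  proof (cases "x \<in> \<Omega>")
    case True
    then show ?thesis using assms(16)[of x t] assms(19)[of x t] assms(21)[of x] that by force
  qed (use outside that in auto)
  have m: "m \<epsilon> > 0" using assms(3,4) by (simp add: admissible_lower_def)
  \<comment> \<open>The order at time t is needed on the whole space, since the balls around x in
    \<Omega> may leave \<Omega>.\<close>
  have step: "u_under (x, t + ?h) \<le> u_over (x, t + ?h)"
    if t: "t > - \<epsilon>\<^sup>2 / 2" and le: "\<And>y. u_under (y, t) \<le> u_over (y, t)" for x t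
  proof (cases "x \<in> \<Omega>")
    case True
    have "A_op p m M \<epsilon> (\<lambda>y. u_under (y, t)) x \<le> A_op p m M \<epsilon> (\<lambda>y. u_over (y, t)) x"
      by (rule A_op_mono) (use assms(1,3,6,11-14) m slice le in auto)
    then show ?thesis
      using assms(15)[OF True t] assms(18)[OF True t] by (simp add: A_op_time_def)
  next
    case False
    then show ?thesis using outside[of x "t + ?h"] t h by linarith
  qed
  have a: "u_under (x, t0 + real (j + 1) * \<epsilon>\<^sup>2 / 2) \<le> u_over (x, t0 + real (j + 1) * \<epsilon>\<^sup>2 / 2)"
    if "t0 \<in> {- \<epsilon>\<^sup>2 / 2<..0}"
      and "\<And>x. u_under (x, t0 + real j * \<epsilon>\<^sup>2 / 2) \<le> u_over (x, t0 + real j * \<epsilon>\<^sup>2 / 2)" for t0 j x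
  proof -
    have "real j * \<epsilon>\<^sup>2 / 2 \<ge> 0" by simp
    then have "t0 + real j * \<epsilon>\<^sup>2 / 2 > - \<epsilon>\<^sup>2 / 2" using that(1) unfolding greaterThanAtMost_iff by linarith
    from step[OF this that(2), of x] show ?thesis by (simp add: algebra_simps add_divide_distrib)
  qed
  have iterate: "u_under (x, t0 + real j * \<epsilon>\<^sup>2 / 2) \<le> u_over (x, t0 + real j * \<epsilon>\<^sup>2 / 2)"
    if "t0 \<in> {- \<epsilon>\<^sup>2 / 2<..0}" for t0 j x
  proof (induction j arbitrary: x)
    case 0
    then show ?case using initial[OF that] by simp
  next
    case (Suc j)
    then show ?case using a[OF that, of j x] by simp
  qed
  have "u_under (x, t) \<le> u_over (x, t)" if t: "t > - \<epsilon>\<^sup>2 / 2" for x t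
  proof -
    \<comment> \<open>The ceiling gives k - 1 < t/h <= k, so t - kh lies in the half-open window
      (-h, 0]; t/h > -1 makes k a natural number.\<close>
    define k where "k = \<lceil>t / ?h\<rceil>"
    have "t / ?h > -1" using t \<open>\<epsilon> > 0\<close> by (simp add: divide_simps)
    then have "k \<ge> 0" unfolding k_def by linarith
    then have k: "real (nat k) = of_int k" by simp
    have "of_int k - 1 < t / ?h" "t / ?h \<le> of_int k"
      unfolding k_def by linarith+
    then have "(of_int k - 1) * ?h < t" "t \<le> of_int k * ?h"
      using h by (simp_all only: pos_less_divide_eq pos_divide_le_eq)
    then have "t - of_int k * ?h \<in> {- \<epsilon>\<^sup>2 / 2<..0}"
      by (simp add: left_diff_distrib)
    from iterate[OF this, of x "nat k"] show ?thesis by (simp add: k)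
  qed
  with a show ?thesis by blast
qed

end
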